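(* Let $k=2$. For any tree metric with diameter $\mathrm{diam}$ and any request sequence $\sigma$, when DCA serves $\sigma$ each of the two servers $i$ incurs cost $c_i\le 1.5\cdot\frac{\mathrm{cost}(\mathrm{DCA},\sigma)}{2}+1.75\cdot\mathrm{diam}$; that is, DCA is $(1.5,1.75\cdot\mathrm{diam})$-fair for any tree metric when $k=2$.
   Context: $k$-server problem: $k$ servers in a metric space serve an online sequence of requests; after request $\sigma_t$ some server must be at $\sigma_t$, and moving costs the distance traveled; $c_i$ is server $i$'s total distance moved, $\mathrm{cost}(\mathrm{DCA},\sigma)=\sum_i c_i$. A tree metric is the set of points of an edge-weighted tree (including interior points of edges) with shortest-path distance; $\mathrm{diam}$ is its diameter. Double Coverage Algorithm (DCA): when a request arrives at $r$, all servers that are unblocked (no other server lies on their unique path to $r$) move toward $r$ at equal speed; a server that becomes blocked stops; movement halts when some server reaches $r$. $(\alpha,\beta)$-fair (w.r.t. own cost) means every server satisfies $c_i\le\alpha\,\mathrm{cost}/k+\beta$ on every input. *)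

theory Defs
  imports Complex_Main
begin

section \<open>Edge-weighted trees and their metric spaces of points\<close>

text \<open>
  Edges are two-element sets of vertices.  The vertex set may be infinite.
\<close>

definition walk :: "'v set \<Rightarrow> 'v set set \<Rightarrow> 'v list \<Rightarrow> bool" where
  "walk V E xs \<longleftrightarrow> xs \<noteq> [] \<and> set xs \<subseteq> V \<and>
     (\<forall>i. Suc i < length xs \<longrightarrow> {xs ! i, xs ! Suc i} \<in> E)"

definition walk_length :: "('v set \<Rightarrow> real) \<Rightarrow> 'v list \<Rightarrow> real" where
  "walk_length w xs = (\<Sum>i<length xs - 1. w {xs ! i, xs ! Suc i})"

definition cycle :: "'v set \<Rightarrow> 'v set set \<Rightarrow> 'v list \<Rightarrow> bool" where
  "cycle V E xs \<longleftrightarrow> walk V E xs \<and> distinct xs \<and> 3 \<le> length xs \<and> {last xs, hd xs} \<in> E"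

locale weighted_tree =
  fixes V :: "'v set" and E :: "'v set set" and w :: "'v set \<Rightarrow> real"
  assumes vertices_nonempty: "V \<noteq> {}"
    and edges: "e \<in> E \<Longrightarrow> e \<subseteq> V \<and> card e = 2"
    and weight_pos: "e \<in> E \<Longrightarrow> 0 < w e"
    and connected: "a \<in> V \<Longrightarrow> b \<in> V \<Longrightarrow> \<exists>xs. walk V E xs \<and> hd xs = a \<and> last xs = b"
    and acyclic: "\<not> (\<exists>xs. cycle V E xs)"

text \<open>
  Points are given by barycentric coordinates: a point is a function on the vertices whose support
  is either a single vertex (the point is that vertex) or an edge \<open>{a, b}\<close> (the point lies in the
  interior of that edge, at distance \<open>(1 - x a) * w {a, b}\<close> from \<open>a\<close> and
  \<open>(1 - x b) * w {a, b}\<close> from \<open>b\<close>).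
\<close>

type_synonym 'v point = "'v \<Rightarrow> real"

definition supp :: "'v point \<Rightarrow> 'v set" where
  "supp x = {v. x v \<noteq> 0}"

definition tree_points :: "'v set \<Rightarrow> 'v set set \<Rightarrow> 'v point set" where
  "tree_points V E = {x. (supp x \<in> E \<or> (\<exists>v\<in>V. supp x = {v})) \<and>
     (\<forall>v. 0 \<le> x v) \<and> (\<Sum>v\<in>supp x. x v) = 1}"

text \<open>
  The distance from \<open>x\<close> to a vertex \<open>a\<close> in its support, along the edge containing \<open>x\<close>.  It is \<open>0\<close>
  if \<open>x\<close> is the vertex \<open>a\<close>, because then \<open>x a = 1\<close>; the value of \<open>w\<close> at \<open>{a}\<close> plays no role.
\<close>

definition leg :: "('v set \<Rightarrow> real) \<Rightarrow> 'v point \<Rightarrow> 'v \<Rightarrow> real" where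
  "leg w x a = (1 - x a) * w (supp x)"

text \<open>
  The lengths of the routes from \<open>x\<close> to \<open>y\<close>: inside one common edge, or leaving \<open>x\<close> at a vertex \<open>a\<close>,
  walking through the tree to a vertex \<open>b\<close>, and reaching \<open>y\<close> from there.
\<close>

definition route_lengths ::
  "'v set \<Rightarrow> 'v set set \<Rightarrow> ('v set \<Rightarrow> real) \<Rightarrow> 'v point \<Rightarrow> 'v point \<Rightarrow> real set" where
  "route_lengths V E w x y =
     {\<bar>x a - y a\<bar> * w (supp x) | a. supp x = supp y \<and> a \<in> supp x} \<union>
     {leg w x (hd xs) + walk_length w xs + leg w y (last xs) | xs.
        walk V E xs \<and> hd xs \<in> supp x \<and> last xs \<in> supp y}"

definition tree_dist ::
  "'v set \<Rightarrow> 'v set set \<Rightarrow> ('v set \<Rightarrow> real) \<Rightarrow> 'v point \<Rightarrow> 'v point \<Rightarrow> real" where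
  "tree_dist V E w x y = Inf (route_lengths V E w x y)"

definition distances :: "'p set \<Rightarrow> ('p \<Rightarrow> 'p \<Rightarrow> real) \<Rightarrow> real set" where
  "distances M d = {d x y | x y. x \<in> M \<and> y \<in> M}"

definition diam :: "'p set \<Rightarrow> ('p \<Rightarrow> 'p \<Rightarrow> real) \<Rightarrow> real" where
  "diam M d = Sup (distances M d)"


section \<open>The Double Coverage Algorithm\<close>

text \<open>
  The space of points is \<open>M\<close> with distance \<open>d\<close>; the servers are the numbers below \<open>k\<close>.
  In a tree there is exactly one path between two points; \<open>path_param M d \<gamma> a b\<close> says
  that \<open>\<gamma>\<close> is its parametrization by arc length.
\<close>

type_synonym 'p config = "nat \<Rightarrow> 'p"

definition path_param :: "'p set \<Rightarrow> ('p \<Rightarrow> 'p \<Rightarrow> real) \<Rightarrow> (real \<Rightarrow> 'p) \<Rightarrow> 'p \<Rightarrow> 'p \<Rightarrow> bool" where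
  "path_param M d \<gamma> a b \<longleftrightarrow> \<gamma> 0 = a \<and> \<gamma> (d a b) = b \<and> \<gamma> ` {0..d a b} \<subseteq> M \<and>
     (\<forall>s\<in>{0..d a b}. \<forall>t\<in>{0..d a b}. d (\<gamma> s) (\<gamma> t) = \<bar>s - t\<bar>)"

definition on_path :: "'p set \<Rightarrow> ('p \<Rightarrow> 'p \<Rightarrow> real) \<Rightarrow> 'p \<Rightarrow> 'p \<Rightarrow> 'p \<Rightarrow> bool" where
  "on_path M d z a b \<longleftrightarrow> (\<exists>\<gamma>. path_param M d \<gamma> a b \<and> z \<in> \<gamma> ` {0..d a b})"

text \<open>
  Servers at the same point would all block each other forever.  Such ties are broken by \<open>prio\<close>:
  the server with the least value blocks the others and is not blocked by them.
\<close>

definition blocked ::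
  "'p set \<Rightarrow> ('p \<Rightarrow> 'p \<Rightarrow> real) \<Rightarrow> nat \<Rightarrow> (nat \<Rightarrow> nat) \<Rightarrow> 'p \<Rightarrow> 'p config \<Rightarrow> nat \<Rightarrow> bool" where
  "blocked M d k prio r p i \<longleftrightarrow>
     (\<exists>j<k. j \<noteq> i \<and> on_path M d (p j) (p i) r \<and> (p j = p i \<longrightarrow> prio j < prio i))"

text \<open>
  Serving the request \<open>r\<close> takes the configuration \<open>p\<close> to \<open>q\<close>.  The movement lasts from time \<open>0\<close> to
  time \<open>T\<close>, the first time at which some server is at \<open>r\<close>.  Server \<open>i\<close> moves with unit speed along
  its path \<open>\<gamma> i\<close> to \<open>r\<close> up to time \<open>s i\<close> and then stays where it is.  At every time \<open>t < T\<close> the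
  servers that are moving are exactly the unblocked ones.  The priorities \<open>prio\<close> are arbitrary
  but injective, and may differ from request to request.
\<close>

definition dca_step ::
  "'p set \<Rightarrow> ('p \<Rightarrow> 'p \<Rightarrow> real) \<Rightarrow> nat \<Rightarrow> 'p \<Rightarrow> 'p config \<Rightarrow> 'p config \<Rightarrow> bool" where
  "dca_step M d k r p q \<longleftrightarrow>
     (\<exists>prio \<gamma> s T x.
        inj_on prio {..<k} \<and> 0 \<le> T \<and>
        (\<forall>i<k. path_param M d (\<gamma> i) (p i) r \<and> 0 \<le> s i \<and> s i \<le> T) \<and>
        (\<forall>t i. x t i = \<gamma> i (min t (s i))) \<and>
        (\<forall>t i. 0 \<le> t \<and> t < T \<and> i < k \<longrightarrow> (t < s i \<longleftrightarrow> \<not> blocked M d k prio r (x t) i)) \<and>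
        (\<forall>t i. 0 \<le> t \<and> t < T \<and> i < k \<longrightarrow> x t i \<noteq> r) \<and>
        (\<exists>i<k. x T i = r) \<and>
        (\<forall>i<k. q i = x T i))"

text \<open>
  \<open>C t\<close> is the configuration after the first \<open>t\<close> requests; the initial one is arbitrary.
\<close>

definition dca_run ::
  "'p set \<Rightarrow> ('p \<Rightarrow> 'p \<Rightarrow> real) \<Rightarrow> nat \<Rightarrow> 'p list \<Rightarrow> (nat \<Rightarrow> 'p config) \<Rightarrow> bool" where
  "dca_run M d k \<sigma> C \<longleftrightarrow> set \<sigma> \<subseteq> M \<and> (\<forall>i<k. C 0 i \<in> M) \<and>
     (\<forall>t<length \<sigma>. dca_step M d k (\<sigma> ! t) (C t) (C (Suc t)))"


section \<open>Costs and fairness\<close>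

text \<open>
  While a request is served, a server only moves along the path to that request, so the distance it
  travels is the distance between its positions before and after.
\<close>

definition server_cost ::
  "('p \<Rightarrow> 'p \<Rightarrow> real) \<Rightarrow> (nat \<Rightarrow> 'p config) \<Rightarrow> nat \<Rightarrow> nat \<Rightarrow> real" where
  "server_cost d C n i = (\<Sum>t<n. d (C t i) (C (Suc t) i))"

definition total_cost ::
  "('p \<Rightarrow> 'p \<Rightarrow> real) \<Rightarrow> nat \<Rightarrow> (nat \<Rightarrow> 'p config) \<Rightarrow> nat \<Rightarrow> real" where
  "total_cost d k C n = (\<Sum>i<k. server_cost d C n i)"

text \<open>
  An algorithm is given by its possible runs; \<open>run \<sigma> C\<close> says that it may serve \<open>\<sigma>\<close> through the
  successive configurations \<open>C 0, C 1, \<dots>\<close>.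
\<close>

definition fair ::
  "('p \<Rightarrow> 'p \<Rightarrow> real) \<Rightarrow> nat \<Rightarrow> ('p list \<Rightarrow> (nat \<Rightarrow> 'p config) \<Rightarrow> bool) \<Rightarrow> real \<Rightarrow> real \<Rightarrow> bool" where
  "fair d k run \<alpha> \<beta> \<longleftrightarrow>
     (\<forall>\<sigma> C. run \<sigma> C \<longrightarrow> (\<forall>i<k. server_cost d C (length \<sigma>) i
        \<le> \<alpha> * (total_cost d k C (length \<sigma>) / real k) + \<beta>))"


section \<open>Finite trees have a finite diameter\<close>

lemma (in weighted_tree) finite_imp_bdd_above_distances:
  assumes "finite V"
  shows "bdd_above (distances (tree_points V E) (tree_dist V E w))"
proof -
  have finE: "finite E"
    by (rule finite_subset[of _ "Pow V"]) (use edges assms in auto)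
  define W where "W = (\<Sum>e\<in>E. w e)"
  have W: "w e \<le> W" if "e \<in> E" for e
    unfolding W_def using that finE weight_pos by (intro member_le_sum) (auto intro: less_imp_le)
  have W0: "0 \<le> W" unfolding W_def using weight_pos by (intro sum_nonneg) (auto intro: less_imp_le)
  have supp_V: "supp x \<subseteq> V" if "x \<in> tree_points V E" for x
    using that edges unfolding tree_points_def by auto
  have le1: "x a \<le> 1 \<and> 0 \<le> x a" if "x \<in> tree_points V E" "a \<in> supp x" for x a
  proof -
    have "finite (supp x)" using supp_V[OF that(1)] assms by (rule finite_subset)
    with that member_le_sum[of a "supp x" x] show ?thesis
      unfolding tree_points_def by auto
  qed
  have leg: "leg w x a \<le> W \<and> 0 \<le> leg w x a" if x: "x \<in> tree_points V E" and a: "a \<in> supp x" for x a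
  proof (cases "supp x \<in> E")
    case True
    have "(1 - x a) * w (supp x) \<le> 1 * W"
      using le1[OF x a] W[OF True] weight_pos[OF True] by (intro mult_mono) auto
    with le1[OF x a] weight_pos[OF True] show ?thesis unfolding leg_def by simp
  next
    case False
    then obtain v where "supp x = {v}" "(\<Sum>v\<in>supp x. x v) = 1"
      using x unfolding tree_points_def by auto
    with a have "x a = 1" by auto
    then show ?thesis using W0 by (simp add: leg_def)
  qed
  have walk0: "0 \<le> walk_length w xs" if "walk V E xs" for xs
    unfolding walk_length_def
    by (rule sum_nonneg, rule less_imp_le, rule weight_pos) (use that in \<open>auto simp: walk_def\<close>)
  have "\<forall>a b. \<exists>xs. a \<in> V \<longrightarrow> b \<in> V \<longrightarrow> walk V E xs \<and> hd xs = a \<and> last xs = b"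
    using connected by blast
  then obtain f where f: "\<And>a b. a \<in> V \<Longrightarrow> b \<in> V \<Longrightarrow> walk V E (f a b) \<and> hd (f a b) = a \<and> last (f a b) = b"
    by metis
  define L where "L = (\<Sum>(a, b)\<in>V \<times> V. walk_length w (f a b))"
  have L: "walk_length w (f a b) \<le> L" if "a \<in> V" "b \<in> V" for a b
    unfolding L_def using member_le_sum[of "(a, b)" "V \<times> V" "\<lambda>(a, b). walk_length w (f a b)"]
      that assms f walk0 by auto
  have supp_ne: "\<exists>a. a \<in> supp x" if "x \<in> tree_points V E" for x
    using that unfolding tree_points_def by (cases "supp x = {}") auto
  have "tree_dist V E w x y \<le> W + L + W"
    if x: "x \<in> tree_points V E" and y: "y \<in> tree_points V E" for x y
  proof -
    obtain a b where ab: "a \<in> supp x" "b \<in> supp y" using supp_ne x y by blast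
    have abV: "a \<in> V" "b \<in> V" using supp_V x y ab by auto
    have wp: "0 \<le> \<bar>x c - y c\<bar> * w (supp x)" if c: "supp x = supp y" "c \<in> supp x" for c
    proof (cases "supp x \<in> E")
      case True
      then show ?thesis using weight_pos[OF True] by simp
    next
      case False
      then obtain v where v: "supp x = {v}" "(\<Sum>v\<in>supp x. x v) = 1" "(\<Sum>v\<in>supp y. y v) = 1"
        using x y unfolding tree_points_def by auto
      moreover have "supp y = {v}" "c = v" using v(1) c by auto
      ultimately have "x c = 1" "y c = 1" by simp_all
      then show ?thesis by simp
    qed
    have nonneg: "0 \<le> l" if "l \<in> route_lengths V E w x y" for l
      using that leg[OF x] leg[OF y] walk0 wp unfolding route_lengths_def
      by (auto intro!: add_nonneg_nonneg)
    have "leg w x (hd (f a b)) + walk_length w (f a b) + leg w y (last (f a b))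
        \<in> route_lengths V E w x y"
      unfolding route_lengths_def
      by (intro UnI2 CollectI exI[of _ "f a b"]) (use f[OF abV] ab in simp)
    then have "tree_dist V E w x y
        \<le> leg w x (hd (f a b)) + walk_length w (f a b) + leg w y (last (f a b))"
      unfolding tree_dist_def using nonneg by (intro cInf_lower bdd_belowI[of _ 0]) auto
    also have "\<dots> \<le> W + L + W"
      using leg[OF x ab(1)] leg[OF y ab(2)] L[OF abV] f[OF abV] by simp
    finally show ?thesis .
  qed
  then show ?thesis unfolding distances_def by (intro bdd_aboveI[of _ "W + L + W"]) auto
qed

end

(*
  While both servers move, each of them covers the same distance and the distance between them
  drops by at most the sum of the two movements; once one of them is blocked, the other one moves
  away from it along a geodesic, so that their distance grows by exactly what the free server
  travels.  Hence c_i - 3 c_j is bounded, request by request, by the growth of the distance between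
  the two servers, and telescoping gives c_i \<le> 3 c_j + diam.
*)
theory Submission
  imports Defs
begin

section \<open>Two servers in a pseudometric space\<close>

text \<open>The two-server argument takes only these laws from the tree; the geodesics come with
  \<open>dca_step\<close> itself, through \<open>path_param\<close>.\<close>

locale pseudometric_on =
  fixes M :: "'p set" and d :: "'p \<Rightarrow> 'p \<Rightarrow> real"
  assumes nonneg: "x \<in> M \<Longrightarrow> y \<in> M \<Longrightarrow> 0 \<le> d x y"
    and sym: "x \<in> M \<Longrightarrow> y \<in> M \<Longrightarrow> d x y = d y x"
    and triangle: "x \<in> M \<Longrightarrow> y \<in> M \<Longrightarrow> z \<in> M \<Longrightarrow> d x z \<le> d x y + d y z"
begin

text \<open>Arc-length parametrization splits the path at parameter \<open>u\<close> into lengths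
  \<open>u\<close> and \<open>d a b - u\<close>. This turns blocking into an equation between
  distances.\<close>

lemma on_path_additive:
  assumes "on_path M d z a b"
  shows "d a b = d a z + d z b"
proof -
  obtain \<gamma> u where \<gamma>: "path_param M d \<gamma> a b" and u: "u \<in> {0..d a b}" and z: "z = \<gamma> u"
    using assms unfolding on_path_def by auto
  have "d (\<gamma> s) (\<gamma> t) = \<bar>s - t\<bar>" if "s \<in> {0..d a b}" "t \<in> {0..d a b}" for s t
    using \<gamma> that unfolding path_param_def by blast
  from this[of 0 u] this[of u "d a b"] have "d (\<gamma> 0) (\<gamma> u) = u" "d (\<gamma> u) (\<gamma> (d a b)) = d a b - u"
    using u by auto
  then show ?thesis
    using \<gamma> z unfolding path_param_def by auto
qed

text \<open>If \<open>i\<close> stops no later than \<open>j\<close>, the triangle inequality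
  suffices; otherwise blocking determines the final distance. Membership of \<open>q i\<close> in
  \<open>M\<close> is what carries the bound from one request to the next.\<close>

lemma dca_step_cost_diff:
  assumes step: "dca_step M d 2 r p q" and M: "r \<in> M" "\<And>i. i < 2 \<Longrightarrow> p i \<in> M"
    and ij: "i < 2" "j < 2" "i \<noteq> j"
  shows "d (p i) (q i) + d (p i) (p j) \<le> 3 * d (p j) (q j) + d (q i) (q j)"
    and "q i \<in> M"
proof -
  obtain prio \<gamma> s T x where T: "0 \<le> T"
    and path: "\<And>i. i < 2 \<Longrightarrow> path_param M d (\<gamma> i) (p i) r \<and> 0 \<le> s i \<and> s i \<le> T"
    and x: "\<And>t i. x t i = \<gamma> i (min t (s i))"
    and moves: "\<And>t i. 0 \<le> t \<Longrightarrow> t < T \<Longrightarrow> i < 2 \<Longrightarrow> t < s i \<longleftrightarrow> \<not> blocked M d 2 prio r (x t) i"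
    and before: "\<And>t i. 0 \<le> t \<Longrightarrow> t < T \<Longrightarrow> i < 2 \<Longrightarrow> x t i \<noteq> r"
    and reached: "\<exists>i<2. x T i = r"
    and q: "\<And>i. i < 2 \<Longrightarrow> q i = x T i"
    using step unfolding dca_step_def by blast
  \<comment> \<open>\<open>path_param\<close> controls \<open>\<gamma> n\<close> only up to
    \<open>d (p n) r\<close>. A server moving longer would stand at \<open>r\<close> at that time,
    which precedes \<open>T\<close>.\<close>
  have s_le: "s n \<le> d (p n) r" if n: "n < 2" for n
  proof (rule ccontr)
    assume less: "\<not> s n \<le> d (p n) r"
    then have "x (d (p n) r) n = r"
      using path[OF n] x by (simp add: path_param_def)
    with before[of "d (p n) r" n] show False
      using less path[OF n] nonneg[OF M(2)[OF n] M(1)] n by auto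
  qed
  have dist: "d (\<gamma> n u) (\<gamma> n v) = \<bar>u - v\<bar>" and in_M: "\<gamma> n u \<in> M"
    if "n < 2" "0 \<le> u" "u \<le> s n" "0 \<le> v" "v \<le> s n" for n u v
    using path[OF that(1)] s_le[OF that(1)] that unfolding path_param_def by (auto simp: image_subset_iff)
  have start: "\<gamma> n 0 = p n" and stop: "q n = \<gamma> n (s n)" if "n < 2" for n
    using path[OF that] q[OF that] x by (auto simp: path_param_def)
  have cost: "d (p n) (q n) = s n" and q_M: "q n \<in> M" if n: "n < 2" for n
    using dist[OF n, of 0 "s n"] in_M[OF n, of "s n" 0] start[OF n] stop[OF n] path[OF n] by auto
  show "q i \<in> M"
    by (rule q_M[OF ij(1)])
  note pq_M = M(2)[OF ij(1)] M(2)[OF ij(2)] q_M[OF ij(1)] q_M[OF ij(2)]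
  show "d (p i) (q i) + d (p i) (p j) \<le> 3 * d (p j) (q j) + d (q i) (q j)"
  proof (cases "s i \<le> s j")
    case True
    \<comment> \<open>The costs are \<open>s i\<close> and \<open>s j\<close>, so what remains is
      \<open>2 * s i + s j \<le> 3 * s j\<close>.\<close>
    have "d (p i) (p j) \<le> d (p i) (q i) + d (q i) (q j) + d (q j) (p j)"
      using triangle[of "p i" "q i" "p j"] triangle[of "q i" "q j" "p j"] pq_M by linarith
    then show ?thesis
      using True cost ij sym[of "q j" "p j"] pq_M by simp
  next
    case False
    \<comment> \<open>The positions of \<open>j\<close> and \<open>i\<close> at the moment
      \<open>j\<close> stops, when \<open>i\<close> is still moving.\<close>
    define y z where "y = x (s j) j" and "z = x (s j) i"
    have sj: "0 \<le> s j" "s j < T" "s j < s i"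
      using False path[OF ij(1)] path[OF ij(2)] by auto
    have y: "y = q j" and z: "z = \<gamma> i (s j)"
      using x stop[OF ij(2)] sj by (auto simp: y_def z_def)
    \<comment> \<open>At time \<open>s j\<close> the strict test \<open>t < s j\<close> fails, so
      \<open>moves\<close> reports \<open>j\<close> as blocked; with two servers only
      \<open>i\<close> can block it.\<close>
    have "blocked M d 2 prio r (x (s j)) j"
      using moves[OF sj(1,2) ij(2)] by simp
    then have "on_path M d z y r"
      using ij unfolding blocked_def y_def z_def by (metis less_2_cases)
    then have yr: "d y r = d y z + d z r"
      by (rule on_path_additive)
    \<comment> \<open>\<open>j\<close> stays at \<open>y\<close> from a time before \<open>T\<close>
      on, and \<open>y\<close> is not \<open>r\<close>, so the server that reaches \<open>r\<close>
      is \<open>i\<close>.\<close>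
    have "x T j \<noteq> r"
      using before[OF sj(1,2) ij(2)] x sj by auto
    then have qi: "q i = r"
      using reached q[OF ij(1)] ij by (metis less_2_cases)
    have z_M: "z \<in> M"
      using in_M[OF ij(1), of "s j" 0] sj z by simp
    \<comment> \<open>Cut the trip of \<open>i\<close> at \<open>z\<close>: the initial distance is
      at most \<open>2 * s j + d y z\<close>, the final one is exactly
      \<open>d y z + s i - s j\<close>. They differ by at most \<open>3 * s j - s i\<close>, whence
      the factor 3.\<close>
    have "d z r = s i - s j"
      using dist[OF ij(1), of "s j" "s i"] sj z qi stop[OF ij(1)] by simp
    moreover have "d (p i) z = s j"
      using dist[OF ij(1), of 0 "s j"] sj z start[OF ij(1)] by simp
    moreover have "d (p i) (p j) \<le> d (p i) z + d z y + d y (p j)"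
      using triangle[of "p i" z "p j"] triangle[of z y "p j"] pq_M z_M y by simp
    moreover have "d y (p j) = s j"
      using cost[OF ij(2)] sym pq_M y by simp
    moreover have "d (q i) (q j) = d y r" "d z y = d y z"
      using qi y z_M pq_M sym by auto
    ultimately show ?thesis
      using yr cost ij by simp
  qed
qed

section \<open>From one request to a whole run\<close>

lemma dca_run_in_space:
  assumes run: "dca_run M d 2 \<sigma> C" and "t \<le> length \<sigma>" "i < 2"
  shows "C t i \<in> M"
  using assms(2,3)
proof (induction t arbitrary: i)
  case 0
  with run show ?case unfolding dca_run_def by simp
next
  case (Suc t)
  then have "\<sigma> ! t \<in> M" "dca_step M d 2 (\<sigma> ! t) (C t) (C (Suc t))"
    using run nth_mem[of t \<sigma>] unfolding dca_run_def by auto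
  \<comment> \<open>\<open>1 - i\<close> is the other server, which the one-step lemma takes as its
    \<open>j\<close>.\<close>
  moreover have "1 - i < 2" "i \<noteq> 1 - i" using Suc.prems by arith+
  ultimately show ?case
    using Suc dca_step_cost_diff(2)[of "\<sigma> ! t" "C t" "C (Suc t)" i "1 - i"] by simp
qed

lemma dca_run_cost_diff:
  assumes run: "dca_run M d 2 \<sigma> C" and "n \<le> length \<sigma>" and ij: "i < 2" "j < 2" "i \<noteq> j"
  shows "server_cost d C n i + d (C 0 i) (C 0 j) \<le> 3 * server_cost d C n j + d (C n i) (C n j)"
  using assms(2)
proof (induction n)
  case 0
  show ?case by (simp add: server_cost_def)
next
  case (Suc n)
  then have "\<sigma> ! n \<in> M" "dca_step M d 2 (\<sigma> ! n) (C n) (C (Suc n))"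
    using run nth_mem[of n \<sigma>] unfolding dca_run_def by auto
  moreover have "C n m \<in> M" if "m < 2" for m
    using dca_run_in_space[OF run] Suc.prems that by simp
  ultimately show ?case
    using Suc dca_step_cost_diff(1)[of "\<sigma> ! n" "C n" "C (Suc n)" i j] ij
    by (simp add: server_cost_def)
qed

theorem dca_two_servers_fair:
  assumes bdd: "bdd_above (distances M d)"
  shows "fair d 2 (dca_run M d 2) (1.5) (1.75 * diam M d)"
  unfolding fair_def
proof (intro allI impI)
  fix \<sigma> C and i :: nat
  assume run: "dca_run M d 2 \<sigma> C" and i: "i < 2"
  define j where "j = 1 - i"
  have ij: "j < 2" "i \<noteq> j" using i unfolding j_def by arith+
  let ?n = "length \<sigma>"
  have C_M: "C t m \<in> M" if "t \<le> ?n" "m < 2" for t m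
    using dca_run_in_space[OF run that] .
  \<comment> \<open>\<open>bdd\<close> makes the \<open>Sup\<close> in \<open>diam\<close> an actual
    upper bound.\<close>
  have "d (C ?n i) (C ?n j) \<le> diam M d"
    unfolding diam_def by (rule cSup_upper[OF _ bdd]) (use C_M i ij in \<open>auto simp: distances_def\<close>)
  moreover have "0 \<le> d (C ?n i) (C ?n j)" "0 \<le> d (C 0 i) (C 0 j)"
    using C_M i ij nonneg by auto
  moreover have "server_cost d C ?n i + d (C 0 i) (C 0 j)
      \<le> 3 * server_cost d C ?n j + d (C ?n i) (C ?n j)"
    by (rule dca_run_cost_diff[OF run order_refl i ij])
  moreover have "total_cost d 2 C ?n = server_cost d C ?n i + server_cost d C ?n j"
    using i unfolding total_cost_def j_def by (auto simp: numeral_2_eq_2 less_Suc_eq)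
  \<comment> \<open>Adding \<open>3 * c_i\<close> to \<open>c_i \<le> 3 * c_j + diam\<close> gives
    \<open>c_i \<le> 1.5 * (cost / 2) + diam / 4\<close>. As the diameter is nonnegative, 1.75
    leaves slack.\<close>
  ultimately show "server_cost d C ?n i \<le> 1.5 * (total_cost d 2 C ?n / real 2) + 1.75 * diam M d"
    by (simp add: field_simps)
qed

end

section \<open>The distance on the points of a tree\<close>

lemma walk_Cons_Cons:
  "walk V E (a # b # xs) \<longleftrightarrow> a \<in> V \<and> {a, b} \<in> E \<and> walk V E (b # xs)"
  unfolding walk_def by (auto simp: nth_Cons split: nat.splits)

lemma walk_append:
  assumes "walk V E xs" "walk V E ys" "{last xs, hd ys} \<in> E"
  shows "walk V E (xs @ ys)"
  using assms
proof (induction xs rule: induct_list012)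
  case (2 a)
  then show ?case by (cases ys) (auto simp: walk_Cons_Cons walk_def[of V E "[a]"])
qed (auto simp: walk_Cons_Cons walk_def[of V E "[]"])

lemma walk_length_Cons_Cons:
  "walk_length w (a # b # xs) = w {a, b} + walk_length w (b # xs)"
  unfolding walk_length_def by (simp add: sum.lessThan_Suc_shift del: sum.lessThan_Suc)

lemma walk_length_append:
  assumes "xs \<noteq> []" "ys \<noteq> []"
  shows "walk_length w (xs @ ys) = walk_length w xs + w {last xs, hd ys} + walk_length w ys"
  using assms
proof (induction xs rule: induct_list012)
  case (2 a)
  then show ?case by (cases ys) (auto simp: walk_length_Cons_Cons walk_length_def[of w "[a]"])
qed (auto simp: walk_length_Cons_Cons)

lemma walk_rev: "walk V E xs \<Longrightarrow> walk V E (rev xs)"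
proof (induction xs rule: induct_list012)
  case (3 a b xs)
  then have "walk V E (rev (b # xs))" "walk V E [a]" "{last (rev (b # xs)), hd [a]} \<in> E"
    by (auto simp: walk_Cons_Cons insert_commute walk_def[of V E "[a]"])
  from walk_append[OF this] show ?case by simp
qed simp_all

lemma walk_length_rev: "walk_length w (rev xs) = walk_length w xs"
proof (induction xs rule: induct_list012)
  case (3 a b xs)
  have "walk_length w (rev (b # xs) @ [a]) = walk_length w (b # xs) + w {b, a}"
    using 3 by (subst walk_length_append) (auto simp: walk_length_def[of w "[a]"])
  then show ?case by (simp add: walk_length_Cons_Cons insert_commute)
qed simp_all

context weighted_tree
begin

abbreviation "points \<equiv> tree_points V E"
abbreviation "dist_points \<equiv> tree_dist V E w"
abbreviation "routes \<equiv> route_lengths V E w"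

section \<open>Points of the tree and their legs\<close>

lemma walk_length_nonneg: "walk V E xs \<Longrightarrow> 0 \<le> walk_length w xs"
  unfolding walk_length_def walk_def by (auto intro!: sum_nonneg less_imp_le[OF weight_pos])

text \<open>The sign of \<open>w (supp x)\<close> is known only when the support is an edge. At a
  vertex the coordinate 1 makes the factor in front of it vanish, so later estimates start from this
  split.\<close>

lemma point_cases:
  assumes "x \<in> points"
  obtains (vertex) v where "v \<in> V" "supp x = {v}" "x v = 1"
    | (edge) u v where "u \<noteq> v" "supp x = {u, v}" "{u, v} \<in> E" "0 \<le> x u" "0 \<le> x v" "x u + x v = 1"
proof (cases "\<exists>v\<in>V. supp x = {v}")
  case True
  then show ?thesis using assms vertex unfolding tree_points_def by auto
next
  case False
  then have E: "supp x \<in> E" using assms unfolding tree_points_def by auto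
  then obtain u v where "supp x = {u, v}" "u \<noteq> v"
    using edges[OF E] by (auto simp: card_2_iff)
  then show ?thesis using assms E edge[of u v] unfolding tree_points_def by auto
qed

lemma supp_in_V: "x \<in> points \<Longrightarrow> supp x \<subseteq> V"
  using edges by (auto elim!: point_cases)

lemma leg_nonneg: "x \<in> points \<Longrightarrow> a \<in> supp x \<Longrightarrow> 0 \<le> leg w x a"
  by (erule point_cases) (auto simp: leg_def intro!: mult_nonneg_nonneg less_imp_le[OF weight_pos])

text \<open>The coordinates sum to 1, so the two legs are complementary pieces of the edge. Needed
  when a route enters a point at one endpoint and leaves it at the other.\<close>

lemma leg_add_leg:
  assumes "x \<in> points" "a \<in> supp x" "b \<in> supp x" "a \<noteq> b"
  shows "leg w x a + leg w x b = w {a, b}" and "{a, b} \<in> E"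
proof -
  from assms(1) have "leg w x a + leg w x b = w {a, b} \<and> {a, b} \<in> E"
  proof (cases rule: point_cases)
    case (edge u v)
    with assms have "x a + x b = 1" and supp: "supp x = {a, b}" by auto
    moreover have "leg w x a + leg w x b = (2 - (x a + x b)) * w (supp x)"
      by (simp add: leg_def algebra_simps)
    ultimately have "leg w x a + leg w x b = w {a, b}" by simp
    then show ?thesis using supp edge by simp
  qed (use assms in auto)
  then show "leg w x a + leg w x b = w {a, b}" "{a, b} \<in> E" by auto
qed

text \<open>What one endpoint gains the other loses, so the length of a direct route does not depend
  on the endpoint chosen.\<close>

lemma coordinate_diff_unique:
  assumes "x \<in> points" "y \<in> points" "supp x = supp y" "a \<in> supp x" "b \<in> supp x"
  shows "\<bar>x a - y a\<bar> = \<bar>x b - y b\<bar>"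
proof -
  have "sum x (supp x) = 1" "sum y (supp x) = 1"
    using assms unfolding tree_points_def by auto
  from assms(1) this assms(4,5) show ?thesis
    by (cases rule: point_cases) auto
qed

lemma weight_supp_scaled_nonneg:
  assumes "x \<in> points" "y \<in> points" "supp x = supp y" "a \<in> supp x"
  shows "0 \<le> \<bar>x a - y a\<bar> * w (supp x)"
  using assms(1)
proof (cases rule: point_cases)
  case (vertex v)
  then have "y v = 1" using assms unfolding tree_points_def by auto
  then show ?thesis using vertex assms by simp
qed (simp add: weight_pos less_imp_le)

section \<open>Routes between points\<close>

lemma direct_route:
  "supp x = supp y \<Longrightarrow> a \<in> supp x \<Longrightarrow> \<bar>x a - y a\<bar> * w (supp x) \<in> routes x y"
  unfolding route_lengths_def by auto

lemma walk_route:
  "walk V E xs \<Longrightarrow> hd xs \<in> supp x \<Longrightarrow> last xs \<in> supp y \<Longrightarrow>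
    leg w x (hd xs) + walk_length w xs + leg w y (last xs) \<in> routes x y"
  unfolding route_lengths_def by auto

lemma routesE:
  assumes "l \<in> routes x y"
  obtains (direct) a where "supp x = supp y" "a \<in> supp x" "l = \<bar>x a - y a\<bar> * w (supp x)"
    | ("walk") xs where "walk V E xs" "hd xs \<in> supp x" "last xs \<in> supp y"
        "l = leg w x (hd xs) + walk_length w xs + leg w y (last xs)"
  using assms unfolding route_lengths_def by auto

lemma routes_sym: "l \<in> routes x y \<Longrightarrow> l \<in> routes y x"
proof (erule routesE)
  fix a assume "supp x = supp y" "a \<in> supp x" "l = \<bar>x a - y a\<bar> * w (supp x)"
  then show ?thesis using direct_route[of y x a] by (simp add: abs_minus_commute)
next
  fix xs assume xs: "walk V E xs" "hd xs \<in> supp x" "last xs \<in> supp y"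
    "l = leg w x (hd xs) + walk_length w xs + leg w y (last xs)"
  then show ?thesis using walk_route[OF walk_rev[OF xs(1)], of y x]
    by (simp add: hd_rev last_rev walk_length_rev add_ac)
qed

lemma routes_nonneg:
  assumes "x \<in> points" "y \<in> points" "l \<in> routes x y"
  shows "0 \<le> l"
  using assms(3)
proof (cases rule: routesE)
  case (direct a)
  then show ?thesis using weight_supp_scaled_nonneg[OF assms(1,2)] by metis
next
  case ("walk" xs)
  then show ?thesis using assms by (simp add: leg_nonneg walk_length_nonneg)
qed

text \<open>With \<open>routes_nonneg\<close>, this makes the \<open>Inf\<close> in
  \<open>tree_dist\<close> a genuine infimum.\<close>

lemma routes_nonempty:
  assumes "x \<in> points" "y \<in> points"
  shows "routes x y \<noteq> {}"
proof -
  obtain a b where ab: "a \<in> supp x" "b \<in> supp y"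
    using assms by (auto elim!: point_cases)
  then obtain xs where "walk V E xs" "hd xs = a" "last xs = b"
    using connected supp_in_V assms by blast
  then show ?thesis using walk_route[of xs x y] ab by auto
qed

section \<open>Joining routes, and the triangle inequality\<close>

lemma walk_join:
  assumes xs: "walk V E xs" and ys: "walk V E ys" and eq: "last xs = hd ys"
  obtains zs where "walk V E zs" "hd zs = hd xs" "last zs = last ys"
    "walk_length w zs = walk_length w xs + walk_length w ys"
proof -
  have "xs \<noteq> []" "ys \<noteq> []" using xs ys unfolding walk_def by auto
  then obtain b bs where b: "ys = b # bs" by (cases ys) auto
  show ?thesis
  proof (cases bs)
    case Nil
    then show ?thesis using that[of xs] b eq xs by (simp add: walk_length_def)
  next
    \<comment> \<open>The shared vertex \<open>b\<close> would occur twice, so only the tail of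
      \<open>ys\<close> is appended; the connecting edge is the first edge of
      \<open>ys\<close>.\<close>
    case (Cons c cs)
    with ys b have "walk V E bs" "{last xs, hd bs} \<in> E"
      using eq by (auto simp: walk_Cons_Cons)
    then show ?thesis
      using that[of "xs @ bs"] walk_append[OF xs, of bs] b eq \<open>xs \<noteq> []\<close> Cons
      by (simp add: walk_length_append walk_length_Cons_Cons)
  qed
qed

text \<open>Sliding from \<open>x\<close> to \<open>y\<close> inside their common edge before
  leaving at \<open>hd xs\<close> is no shorter than leaving \<open>x\<close> there at once.\<close>

lemma direct_then_walk:
  assumes "x \<in> points" "y \<in> points" "supp x = supp y" "a \<in> supp x"
    and xs: "walk V E xs" "hd xs \<in> supp y" "last xs \<in> supp z"
  shows "\<exists>n\<in>routes x z. n \<le> \<bar>x a - y a\<bar> * w (supp x)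
    + (leg w y (hd xs) + walk_length w xs + leg w z (last xs))"
proof -
  let ?h = "hd xs"
  have h: "?h \<in> supp x" using assms by simp
  have "leg w x ?h \<le> \<bar>x ?h - y ?h\<bar> * w (supp x) + leg w y ?h"
    using assms(1)
  proof (cases rule: point_cases)
    case (vertex v)
    then have "y v = 1" using assms unfolding tree_points_def by auto
    then show ?thesis using vertex h assms by (auto simp: leg_def)
  next
    case (edge u v)
    then have "0 < w (supp x)" using weight_pos by simp
    then have "(1 - x ?h) * w (supp x) \<le> (\<bar>x ?h - y ?h\<bar> + (1 - y ?h)) * w (supp x)"
      by (intro mult_right_mono) auto
    then show ?thesis using assms(3) by (simp add: leg_def algebra_simps)
  qed
  then show ?thesis
    using coordinate_diff_unique[OF assms(1-4) h]
    by (intro bexI[OF _ walk_route[where x = x, OF xs(1) h xs(3)]]) simp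
qed

text \<open>The triangle inequality for single routes, before any infimum. The cases are the kinds
  of the two routes, direct or along a walk.\<close>

lemma routes_join:
  assumes x: "x \<in> points" and y: "y \<in> points" and z: "z \<in> points"
    and l: "l \<in> routes x y" and m: "m \<in> routes y z"
  shows "\<exists>n\<in>routes x z. n \<le> l + m"
  using l
proof (cases rule: routesE)
  case (direct a)
  note a = direct
  from m show ?thesis
  proof (cases rule: routesE)
    case (direct b)
    have b: "b \<in> supp x" using direct a by simp
    have "l = \<bar>x b - y b\<bar> * w (supp x)"
      using coordinate_diff_unique[OF x y a(1,2) b] a by simp
    \<comment> \<open>At a vertex all three coordinates are 1, so both sides of the next inequality
      vanish whatever \<open>w\<close> is there.\<close>
    moreover have "0 \<le> w (supp x) \<or> x b = 1 \<and> y b = 1 \<and> z b = 1"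
      using x
    proof (cases rule: point_cases)
      case (vertex v)
      then have "b = v" "supp y = {v}" "supp z = {v}" using a direct by auto
      then show ?thesis using vertex y z unfolding tree_points_def by auto
    qed (use weight_pos in \<open>auto intro: less_imp_le\<close>)
    then have "\<bar>x b - z b\<bar> * w (supp x) \<le> \<bar>x b - y b\<bar> * w (supp x) + \<bar>y b - z b\<bar> * w (supp x)"
    proof
      assume "0 \<le> w (supp x)"
      then have "\<bar>x b - z b\<bar> * w (supp x) \<le> (\<bar>x b - y b\<bar> + \<bar>y b - z b\<bar>) * w (supp x)"
        by (intro mult_right_mono) auto
      then show ?thesis by (simp add: algebra_simps)
    qed simp
    moreover have "\<bar>x b - z b\<bar> * w (supp x) \<in> routes x z" "supp y = supp x"
      using direct_route[of x z b] direct a b by simp_all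
    ultimately show ?thesis
      using direct(3) by (intro bexI) simp_all
  next
    case ("walk" xs)
    then show ?thesis using direct_then_walk[OF x y a(1,2)] a(3) by simp
  qed
next
  case ("walk" xs)
  note xs = this
  from m show ?thesis
  proof (cases rule: routesE)
    case (direct b)
    \<comment> \<open>Mirror image of the direct-then-walk case: reverse both routes, then return by
      \<open>routes_sym\<close>.\<close>
    have "\<exists>n\<in>routes z x. n \<le> \<bar>z b - y b\<bar> * w (supp z)
        + (leg w y (hd (rev xs)) + walk_length w (rev xs) + leg w x (last (rev xs)))"
      using direct xs y z by (intro direct_then_walk walk_rev) (auto simp: hd_rev last_rev)
    moreover have "m = \<bar>z b - y b\<bar> * w (supp z)"
      using direct by (simp add: abs_minus_commute)
    ultimately have "\<exists>n\<in>routes z x. n \<le> l + m"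
      using xs(4) by (simp add: hd_rev last_rev walk_length_rev add_ac)
    then show ?thesis using routes_sym by blast
  next
    case ("walk" ys)
    note ys = this
    show ?thesis
    \<comment> \<open>If the walks meet at one vertex, the excursion to \<open>y\<close> and back is
      dropped. Otherwise the two legs at \<open>y\<close> make up its whole edge, which links the
      walks at length exactly \<open>l + m\<close>.\<close>
    proof (cases "last xs = hd ys")
      case True
      obtain zs where zs: "walk V E zs" "hd zs = hd xs" "last zs = last ys"
        "walk_length w zs = walk_length w xs + walk_length w ys"
        using walk_join[OF xs(1) ys(1) True] .
      have "leg w x (hd zs) + walk_length w zs + leg w z (last zs) \<in> routes x z"
        using zs xs ys by (intro walk_route) auto
      then show ?thesis
        by (rule rev_bexI) (use zs leg_nonneg[OF y xs(3)] leg_nonneg[OF y ys(2)] xs(4) ys(4) in simp)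
    next
      case False
      have ne: "xs \<noteq> []" "ys \<noteq> []" using xs ys unfolding walk_def by auto
      note leg = leg_add_leg[OF y xs(3) ys(2) False]
      have "leg w x (hd (xs @ ys)) + walk_length w (xs @ ys) + leg w z (last (xs @ ys)) \<in> routes x z"
        using walk_append[OF xs(1) ys(1) leg(2)] xs ys ne by (intro walk_route) auto
      then show ?thesis
        by (rule rev_bexI) (use leg(1) xs(4) ys(4) ne in \<open>simp add: walk_length_append\<close>)
    qed
  qed
qed

lemma pseudometric_tree_dist: "pseudometric_on points dist_points"
proof
  fix x y assume xy: "x \<in> points" "y \<in> points"
  show "0 \<le> dist_points x y"
    unfolding tree_dist_def using routes_nonempty[OF xy] routes_nonneg[OF xy]
    by (intro cInf_greatest) auto
  have "routes x y = routes y x" using routes_sym by blast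
  then show "dist_points x y = dist_points y x" by (simp add: tree_dist_def)
  fix z assume z: "z \<in> points"
  \<comment> \<open>The two infima are taken one at a time: first over \<open>m\<close> with
    \<open>l\<close> fixed, then over \<open>l\<close>.\<close>
  have "dist_points x z - l \<le> m" if lm: "l \<in> routes x y" "m \<in> routes y z" for l m
  proof -
    obtain n where n: "n \<in> routes x z" "n \<le> l + m"
      using routes_join[OF xy z lm] by blast
    have "Inf (routes x z) \<le> n"
      using routes_nonneg[OF xy(1) z] by (intro cInf_lower[OF n(1)] bdd_belowI) auto
    with n show ?thesis by (simp add: tree_dist_def)
  qed
  then have "dist_points x z - l \<le> dist_points y z" if "l \<in> routes x y" for l
    unfolding tree_dist_def[of _ _ _ y z] using routes_nonempty[OF xy(2) z] that
    by (intro cInf_greatest) auto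
  then have "dist_points x z - dist_points y z \<le> l" if "l \<in> routes x y" for l
    using that by (simp add: diff_le_eq add.commute)
  then have "dist_points x z - dist_points y z \<le> dist_points x y"
    unfolding tree_dist_def[of _ _ _ x y] using routes_nonempty[OF xy]
    by (intro cInf_greatest) auto
  then show "dist_points x z \<le> dist_points x y + dist_points y z" by simp
qed

end

text \<open>The tree may be infinite; \<open>bdd_above\<close> says that its diameter is finite,
  which \<open>finite_imp_bdd_above_distances\<close> provides for finite trees.\<close>

theorem theorem11:
  fixes V :: "'v set" and E :: "'v set set" and w :: "'v set \<Rightarrow> real"
  assumes "weighted_tree V E w"
    and "bdd_above (distances (tree_points V E) (tree_dist V E w))"
  shows "fair (tree_dist V E w) 2 (dca_run (tree_points V E) (tree_dist V E w) 2)
           (1.5) (1.75 * diam (tree_points V E) (tree_dist V E w))"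
  using pseudometric_on.dca_two_servers_fair[OF weighted_tree.pseudometric_tree_dist] assms
  by blast

end
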